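(* Let $V$ be a real symplectic vector space of dimension $2n$ with linear coordinates $x_1,\dots,x_{2n}$ in which the skew form has matrix $(\omega_{ij})$ with inverse matrix $(\omega^{ij})$. Let $M\subset V\times V^*$ be a submanifold, transversal to both projections, which is Lagrangian for $$\Omega_1=2\sum_i dx_i\wedge d\xi_i,\qquad \Omega_2=\sum_{i,j}\omega_{ij}\,dx_i\wedge dx_j+\sum_{i,j}\omega^{ij}\,d\xi_i\wedge d\xi_j ,$$ and write $M$ locally as the graph $\xi_j=\partial\phi/\partial x_j$ of the derivative of a function $\phi(x_1,\dots,x_{2n})$. Then $\phi$ is a Kähler potential for the special pseudo-Kähler structure on $M$; that is, $d(I\,d\phi)=-\omega$, where $\omega=\sum_{j,k}\omega_{jk}\,dx_j\wedge dx_k$ is the Kähler form and $I$ the complex structure.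
   Context: Here $(\xi_i)$ are the coordinates on $V^*$ dual to $(x_i)$. The space $V\times V^*$ is identified with $V\times V$ (coordinates $(x_i,y_i)$) by $\xi_i=\sum_j\omega_{ij}y_j$. Use $x_1,\dots,x_{2n}$ as local coordinates on $M$. The special pseudo-Kähler structure on $M$ is as follows: the metric is $\sum g_{jk}dx_jdx_k$ with $g_{jk}=\partial^2\phi/\partial x_j\partial x_k$ (nondegenerate by transversality). The complex structure $I$ has components $I^j_k=\sum_a\omega^{ja}g_{ak}$, i.e. $I(\partial/\partial x_k)=\sum_j I^j_k\,\partial/\partial x_j$; it satisfies $I^2=-1$ and is integrable. The flat connection $\nabla$ is ordinary differentiation in the coordinates $x_j$. The Kähler form is represented by $\omega=\sum_{j,k}\omega_{jk}\,dx_j\wedge dx_k$ (sum over all pairs $j,k$). For the 1-form $d\phi$, $I\,d\phi=\sum_{i,j} I^i_j\frac{\partial\phi}{\partial x_i}dx_j$. *)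

theory Defs
  imports "HOL-Analysis.Analysis"
begin

primrec Ck_on :: "nat \<Rightarrow> 'a set \<Rightarrow> ('a::euclidean_space \<Rightarrow> 'b::real_normed_vector) \<Rightarrow> bool" where
  "Ck_on 0 S f \<longleftrightarrow> continuous_on S f"
| "Ck_on (Suc k) S f \<longleftrightarrow>
     (\<forall>x\<in>S. f differentiable (at x)) \<and>
     (\<forall>v. Ck_on k S (\<lambda>x. frechet_derivative f (at x) v))"

text \<open>Only used for open \<open>S\<close>, since the derivatives are taken in the ambient space.\<close>

definition smooth_on :: "'a set \<Rightarrow> ('a::euclidean_space \<Rightarrow> 'b::real_normed_vector) \<Rightarrow> bool" where
  "smooth_on S f \<longleftrightarrow> (\<forall>k. Ck_on k S f)"

text \<open>Embedded smooth submanifolds of dimension \<open>d\<close>: near each point some diffeomorphism between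
  open sets straightens \<open>M\<close> to a \<open>d\<close>-dimensional linear subspace.\<close>

definition submanifold :: "nat \<Rightarrow> ('a::euclidean_space) set \<Rightarrow> bool" where
  "submanifold d M \<longleftrightarrow>
     (\<forall>p\<in>M. \<exists>U V (f :: 'a \<Rightarrow> 'a) g S. open U \<and> p \<in> U \<and> open V \<and>
        homeomorphism U V f g \<and> smooth_on U f \<and> smooth_on V g \<and>
        subspace S \<and> dim S = d \<and> f ` (U \<inter> M) = V \<inter> S)"

text \<open>Velocities at \<open>p\<close> of smooth curves lying in \<open>M\<close>.\<close>

definition tangent_space :: "('a::euclidean_space) set \<Rightarrow> 'a \<Rightarrow> 'a set" where
  "tangent_space M p =
     {v. \<exists>(\<gamma> :: real \<Rightarrow> 'a) \<epsilon>. \<epsilon> > 0 \<and> smooth_on {-\<epsilon><..<\<epsilon>} \<gamma> \<and> \<gamma> ` {-\<epsilon><..<\<epsilon>} \<subseteq> M \<and>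
        \<gamma> 0 = p \<and> (\<gamma> has_vector_derivative v) (at 0)}"

text \<open>Transversality of \<open>M\<close> to a linear projection means transversality to each of its fibres.\<close>

definition transversal_to_projection ::
    "('a::euclidean_space) set \<Rightarrow> ('a \<Rightarrow> 'b::euclidean_space) \<Rightarrow> bool" where
  "transversal_to_projection M \<pi> \<longleftrightarrow>
     (\<forall>p\<in>M. {u + v |u v. u \<in> tangent_space M p \<and> \<pi> v = 0} = UNIV)"

text \<open>Differential forms on a vector space: the first argument is the base point, the others are
  tangent vectors.\<close>

type_synonym 'a form1 = "'a \<Rightarrow> 'a \<Rightarrow> real"
type_synonym 'a form2 = "'a \<Rightarrow> 'a \<Rightarrow> 'a \<Rightarrow> real"

definition differential :: "('a::euclidean_space \<Rightarrow> real) \<Rightarrow> 'a form1" where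
  "differential f = (\<lambda>x v. frechet_derivative f (at x) v)"

text \<open>Normalised without a factor 1/2, so that \<open>ext_deriv (f dg) = df \<and> dg\<close>.\<close>

definition wedge :: "'a form1 \<Rightarrow> 'a form1 \<Rightarrow> 'a form2" where
  "wedge \<alpha> \<beta> = (\<lambda>x u v. \<alpha> x u * \<beta> x v - \<alpha> x v * \<beta> x u)"

definition ext_deriv :: "('a::euclidean_space) form1 \<Rightarrow> 'a form2" where
  "ext_deriv \<alpha> = (\<lambda>x u v. frechet_derivative (\<lambda>y. \<alpha> y v) (at x) u
                         - frechet_derivative (\<lambda>y. \<alpha> y u) (at x) v)"

definition lagrangian_submanifold :: "('a::euclidean_space) form2 \<Rightarrow> 'a set \<Rightarrow> bool" where
  "lagrangian_submanifold \<Omega> M \<longleftrightarrow>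
     (\<exists>d. 2 * d = DIM('a) \<and> submanifold d M) \<and>
     (\<forall>p\<in>M. \<forall>u\<in>tangent_space M p. \<forall>v\<in>tangent_space M p. \<Omega> p u v = 0)"

definition symplectic_form :: "('a::real_vector \<Rightarrow> 'a \<Rightarrow> real) \<Rightarrow> bool" where
  "symplectic_form \<sigma> \<longleftrightarrow> bilinear \<sigma> \<and> (\<forall>u v. \<sigma> u v = - \<sigma> v u) \<and>
     (\<forall>u. (\<forall>v. \<sigma> u v = 0) \<longrightarrow> u = 0)"

definition form_matrix :: "(real^'m \<Rightarrow> real^'m \<Rightarrow> real) \<Rightarrow> real^'m^'m::finite" where
  "form_matrix \<sigma> = (\<chi> i j. \<sigma> (axis i 1) (axis j 1))"

text \<open>\<open>V\<close> is \<open>real^'m\<close> with coordinates \<open>x\<^sub>i\<close>, and \<open>V \<times> V\<^sup>*\<close> is \<open>(real^'m) \<times> (real^'m)\<close>, the second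
  factor carrying the dual coordinates \<open>\<xi>\<^sub>i\<close>.\<close>

definition dX :: "'m::finite \<Rightarrow> ((real^'m) \<times> (real^'m)) form1" where
  "dX i = differential (\<lambda>p. fst p $ i)"

definition dXi :: "'m::finite \<Rightarrow> ((real^'m) \<times> (real^'m)) form1" where
  "dXi i = differential (\<lambda>p. snd p $ i)"

definition Omega1 :: "((real^'m::finite) \<times> (real^'m)) form2" where
  "Omega1 = (\<lambda>p u v. 2 * (\<Sum>i\<in>UNIV. wedge (dX i) (dXi i) p u v))"

definition Omega2 :: "real^'m^'m::finite \<Rightarrow> ((real^'m) \<times> (real^'m)) form2" where
  "Omega2 w = (\<lambda>p u v.
      (\<Sum>i\<in>UNIV. \<Sum>j\<in>UNIV. w $ i $ j * wedge (dX i) (dX j) p u v)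
    + (\<Sum>i\<in>UNIV. \<Sum>j\<in>UNIV. matrix_inv w $ i $ j * wedge (dXi i) (dXi j) p u v))"

definition partial :: "'m::finite \<Rightarrow> (real^'m \<Rightarrow> real) \<Rightarrow> real^'m \<Rightarrow> real" where
  "partial j f x = frechet_derivative f (at x) (axis j 1)"

definition derivative_graph :: "(real^'m::finite) set \<Rightarrow> (real^'m \<Rightarrow> real) \<Rightarrow> ((real^'m) \<times> (real^'m)) set"
  where "derivative_graph U \<phi> = {(x, \<xi>). x \<in> U \<and> (\<forall>j. \<xi> $ j = partial j \<phi> x)}"

text \<open>The special pseudo-Kaehler structure of the graph, in the coordinates \<open>x\<^sub>i\<close>.\<close>

definition kaehler_metric :: "(real^'m \<Rightarrow> real) \<Rightarrow> real^'m \<Rightarrow> real^'m^'m::finite" where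
  "kaehler_metric \<phi> x = (\<chi> j k. partial j (partial k \<phi>) x)"

text \<open>Row index is the upper index: \<open>complex_structure w \<phi> x $ j $ k\<close> is \<open>I\<^sup>j\<^sub>k\<close>.\<close>

definition complex_structure ::
    "real^'m^'m \<Rightarrow> (real^'m \<Rightarrow> real) \<Rightarrow> real^'m \<Rightarrow> real^'m^'m::finite" where
  "complex_structure w \<phi> x = (\<chi> j k. \<Sum>a\<in>UNIV. matrix_inv w $ j $ a * kaehler_metric \<phi> x $ a $ k)"

definition dx :: "'m::finite \<Rightarrow> (real^'m) form1" where
  "dx j = differential (\<lambda>x. x $ j)"

definition kaehler_form :: "real^'m^'m::finite \<Rightarrow> (real^'m) form2" where
  "kaehler_form w = (\<lambda>x u v. \<Sum>j\<in>UNIV. \<Sum>k\<in>UNIV. w $ j $ k * wedge (dx j) (dx k) x u v)"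

text \<open>Action on 1-forms by the transpose: the component of \<open>J \<alpha>\<close> at \<open>dx\<^sub>j\<close> is
  \<open>\<Sum>\<^sub>i J\<^sup>i\<^sub>j \<alpha>\<^sub>i\<close>.\<close>

definition endo_act :: "(real^'m \<Rightarrow> real^'m^'m::finite) \<Rightarrow> (real^'m) form1 \<Rightarrow> (real^'m) form1" where
  "endo_act J \<alpha> = (\<lambda>x v. \<Sum>i\<in>UNIV. \<Sum>j\<in>UNIV. J x $ i $ j * \<alpha> x (axis i 1) * dx j x v)"

definition kaehler_potential_on :: "(real^'m) set \<Rightarrow> (real^'m \<Rightarrow> real^'m^'m::finite) \<Rightarrow>
    (real^'m) form2 \<Rightarrow> (real^'m \<Rightarrow> real) \<Rightarrow> bool" where
  "kaehler_potential_on U J \<omega> \<phi> \<longleftrightarrow>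
     (\<forall>x\<in>U. \<forall>u v. ext_deriv (endo_act J (differential \<phi>)) x u v = - \<omega> x u v)"

end

theory Submission
  imports Defs
begin

text \<open>
  Write \<open>K = w\<inverse>\<close> and let \<open>H\<close> be the Hessian of \<open>\<phi>\<close>. For a constant vector \<open>v\<close>,
  \<open>(I d\<phi>)(v) = \<Sum> K\<^sub>i\<^sub>a \<phi>\<^sub>i (H v)\<^sub>a\<close> (\<open>endo_act_complex_structure_differential\<close>). Differentiate this along \<open>u\<close> and
  antisymmetrise in \<open>u, v\<close>. The third derivatives of \<open>\<phi>\<close> cancel because directional derivatives
  commute, and what is left is (\<open>ext_deriv_complex_structure_differential\<close>)
  \<open>\<Sum> K\<^sub>i\<^sub>j ((H u)\<^sub>i (H v)\<^sub>j - (H v)\<^sub>i (H u)\<^sub>j)\<close>.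

  On the other hand the graph of \<open>d\<phi>\<close> has tangent vectors \<open>(u, H u)\<close>
  (\<open>tangent_vector_derivative_graph\<close>), and on two such vectors the second symplectic form is exactly
  the Kaehler form evaluated at \<open>u, v\<close> plus the expression above (\<open>Omega2_tangent_graph\<close>). The
  Lagrangian condition for that form makes the sum vanish, which is \<open>d(I d\<phi>) = -\<omega>\<close>.

  Two analytic ingredients carry this: the symmetry of second derivatives, used both for \<open>\<phi>\<close>
  (symmetry of \<open>H\<close>) and for its partial derivatives (third order), and enough closure properties of
  smooth functions to see that the lift of a line segment to the graph is a smooth curve.
\<close>

section \<open>Symmetry of second derivatives\<close>

text \<open>
  The second difference of \<open>f\<close> over the parallelogram spanned by \<open>h u\<close> and \<open>h v\<close> is symmetric in
  \<open>u\<close> and \<open>v\<close>; the estimate identifies its leading coefficient as the derivative along \<open>v\<close> of the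
  derivative along \<open>u\<close>. The mean value theorem is applied only in the direction \<open>u\<close>; the step in the
  direction \<open>v\<close> uses differentiability of \<open>D y u\<close> at the single point \<open>x\<close>.
\<close>

lemma second_difference_estimate:
  fixes f :: "'a::real_normed_vector \<Rightarrow> real"
  assumes U: "open U" "x \<in> U"
    and D: "\<And>y. y \<in> U \<Longrightarrow> (f has_derivative D y) (at y)"
    and L: "((\<lambda>y. D y u) has_derivative L) (at x)"
    and e: "e > 0"
  shows "\<exists>d>0. \<forall>h. 0 < h \<and> h < d \<longrightarrow>
    \<bar>f (x + h *\<^sub>R u + h *\<^sub>R v) - f (x + h *\<^sub>R u) - f (x + h *\<^sub>R v) + f x - h\<^sup>2 * L v\<bar> \<le> e * h\<^sup>2"
proof -
  \<comment> \<open>The bound \<open>h * c\<close> dominates \<open>norm (s u + h v) + norm (s u)\<close> for \<open>0 \<le> s \<le> h\<close>; the summand 1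
    keeps \<open>c\<close> positive and the inequality strict.\<close>
  define c where "c = 2 * norm u + norm v + 1"
  have c: "c > 0" unfolding c_def by (simp add: add_nonneg_pos)
  obtain r where r: "r > 0" "ball x r \<subseteq> U"
    using U open_contains_ball by blast
  obtain d where d: "d > 0"
    "\<And>y. norm (y - x) < d \<Longrightarrow> norm (D y u - D x u - L (y - x)) \<le> e / c * norm (y - x)"
    using L e c unfolding has_derivative_at_alt by (metis divide_pos_pos)
  interpret L: bounded_linear L using L by (rule has_derivative_bounded_linear)
  have est: "\<bar>f (x + h *\<^sub>R u + h *\<^sub>R v) - f (x + h *\<^sub>R u) - f (x + h *\<^sub>R v) + f x - h\<^sup>2 * L v\<bar> \<le> e * h\<^sup>2"
    if h: "0 < h" "h < min d r / c" for h
  proof -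
    have hc: "h * c < d" "h * c < r"
      using h c by (auto simp: pos_less_divide_eq)
    have z1: "norm (s *\<^sub>R u + h *\<^sub>R v) \<le> h * (norm u + norm v)" if "0 \<le> s" "s \<le> h" for s
    proof -
      have "norm (s *\<^sub>R u + h *\<^sub>R v) \<le> s * norm u + h * norm v"
        using norm_triangle_ineq[of "s *\<^sub>R u" "h *\<^sub>R v"] that h by simp
      also have "\<dots> \<le> h * (norm u + norm v)"
        using that by (simp add: distrib_left mult_right_mono)
      finally show ?thesis .
    qed
    have z2: "norm (s *\<^sub>R u) \<le> h * norm u" if "0 \<le> s" "s \<le> h" for s
      using that by (simp add: mult_right_mono)
    have hcs: "h * c = 2 * (h * norm u) + h * norm v + h"
      by (simp add: c_def algebra_simps)
    have nn: "0 \<le> h * norm u" "0 \<le> h * norm v" using h by simp_all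
    have b1: "norm (s *\<^sub>R u + h *\<^sub>R v) < h * c" if "0 \<le> s" "s \<le> h" for s
      using z1[OF that] nn h(1) hcs unfolding distrib_left by linarith
    have b2: "norm (s *\<^sub>R u) < h * c" if "0 \<le> s" "s \<le> h" for s
      using z2[OF that] nn h hcs by linarith
    have inU: "x + (s *\<^sub>R u + h *\<^sub>R v) \<in> U" "x + s *\<^sub>R u \<in> U" if "0 \<le> s" "s \<le> h" for s
    proof -
      have "x + (s *\<^sub>R u + h *\<^sub>R v) \<in> ball x r" "x + s *\<^sub>R u \<in> ball x r"
        using b1[OF that] b2[OF that] hc unfolding mem_ball dist_commute[of x] by (simp_all add: dist_norm)
      then show "x + (s *\<^sub>R u + h *\<^sub>R v) \<in> U" "x + s *\<^sub>R u \<in> U"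
        using r(2) by auto
    qed
    define g where "g s = f (x + (s *\<^sub>R u + h *\<^sub>R v)) - f (x + s *\<^sub>R u)" for s
    have dg: "(g has_derivative (\<lambda>t. D (x + (s *\<^sub>R u + h *\<^sub>R v)) (t *\<^sub>R u) - D (x + s *\<^sub>R u) (t *\<^sub>R u)))
        (at s within {0..h})" if "0 \<le> s" "s \<le> h" for s
    proof -
      have "((\<lambda>s. x + (s *\<^sub>R u + h *\<^sub>R v)) has_derivative (\<lambda>t. t *\<^sub>R u)) (at s within {0..h})"
        "((\<lambda>s. x + s *\<^sub>R u) has_derivative (\<lambda>t. t *\<^sub>R u)) (at s within {0..h})"
        by (auto intro!: derivative_eq_intros)
      from has_derivative_diff[OF has_derivative_compose[OF this(1), where g = f, OF D[OF inU(1)[OF that]]]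
          has_derivative_compose[OF this(2), where g = f, OF D[OF inU(2)[OF that]]]]
      show ?thesis unfolding g_def .
    qed
    obtain s where s: "s \<in> {0<..<h}"
      "g h - g 0 = D (x + (s *\<^sub>R u + h *\<^sub>R v)) ((h - 0) *\<^sub>R u) - D (x + s *\<^sub>R u) ((h - 0) *\<^sub>R u)"
      using mvt_simple[OF h(1) dg] by blast
    have s': "0 \<le> s" "s \<le> h" using s by auto
    have lin: "D y (h *\<^sub>R u) = h * D y u" if "y \<in> U" for y
      using linear_scale[OF bounded_linear.linear[OF has_derivative_bounded_linear[OF D[OF that]]], of h u] by simp
    have geq: "g h - g 0 = h * (D (x + (s *\<^sub>R u + h *\<^sub>R v)) u - D (x + s *\<^sub>R u) u)"
      using s(2) lin[OF inU(1)[OF s']] lin[OF inU(2)[OF s']] by (simp add: algebra_simps)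
    \<comment> \<open>Linearising \<open>D y u\<close> at \<open>x\<close> at both points, the terms \<open>D x u\<close> and \<open>L (s u)\<close> cancel, so that
      the unknown \<open>s\<close> survives only in the error.\<close>
    have e1: "\<bar>D (x + (s *\<^sub>R u + h *\<^sub>R v)) u - D x u - L (s *\<^sub>R u + h *\<^sub>R v)\<bar>
        \<le> e / c * norm (s *\<^sub>R u + h *\<^sub>R v)"
      using d(2)[of "x + (s *\<^sub>R u + h *\<^sub>R v)"] b1[OF s'] hc by simp
    have e2: "\<bar>D (x + s *\<^sub>R u) u - D x u - L (s *\<^sub>R u)\<bar> \<le> e / c * norm (s *\<^sub>R u)"
      using d(2)[of "x + s *\<^sub>R u"] b2[OF s'] hc by simp
    have "\<bar>D (x + (s *\<^sub>R u + h *\<^sub>R v)) u - D (x + s *\<^sub>R u) u - h * L v\<bar>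
        \<le> e / c * norm (s *\<^sub>R u + h *\<^sub>R v) + e / c * norm (s *\<^sub>R u)"
      using e1 e2 by (simp add: L.add L.scaleR)
    also have "\<dots> = e / c * (norm (s *\<^sub>R u + h *\<^sub>R v) + norm (s *\<^sub>R u))"
      by (simp only: distrib_left)
    also have "\<dots> \<le> e / c * (h * c)"
    proof (rule mult_left_mono)
      show "norm (s *\<^sub>R u + h *\<^sub>R v) + norm (s *\<^sub>R u) \<le> h * c"
        using z1[OF s'] z2[OF s'] h hcs by (simp add: distrib_left)
      show "0 \<le> e / c" using e c by simp
    qed
    also have "\<dots> = e * h" using c by simp
    finally have est0: "\<bar>D (x + (s *\<^sub>R u + h *\<^sub>R v)) u - D (x + s *\<^sub>R u) u - h * L v\<bar> \<le> e * h" .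
    have "f (x + h *\<^sub>R u + h *\<^sub>R v) - f (x + h *\<^sub>R u) - f (x + h *\<^sub>R v) + f x - h\<^sup>2 * L v
        = h * (D (x + (s *\<^sub>R u + h *\<^sub>R v)) u - D (x + s *\<^sub>R u) u - h * L v)"
      using geq by (simp add: g_def algebra_simps power2_eq_square)
    moreover have "\<bar>h * (D (x + (s *\<^sub>R u + h *\<^sub>R v)) u - D (x + s *\<^sub>R u) u - h * L v)\<bar> \<le> h * (e * h)"
      using mult_left_mono[OF est0, of h] h(1) by (simp only: abs_mult abs_of_pos less_imp_le)
    ultimately show ?thesis by (simp add: power2_eq_square mult.left_commute)
  qed
  have "min d r / c > 0" using d r c by simp
  with est show ?thesis by blast
qed

lemma second_derivative_symmetric:
  fixes f :: "'a::real_normed_vector \<Rightarrow> real"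
  assumes U: "open U" "x \<in> U"
    and D: "\<And>y. y \<in> U \<Longrightarrow> (f has_derivative D y) (at y)"
    and L: "((\<lambda>y. D y u) has_derivative L) (at x)"
    and K: "((\<lambda>y. D y v) has_derivative K) (at x)"
  shows "L v = K u"
proof -
  have "\<bar>L v - K u\<bar> \<le> 0 + e" if "e > 0" for e :: real
  proof -
    have e2: "e / 2 > 0" using that by simp
    obtain d1 where d1: "d1 > 0" "\<And>h. 0 < h \<Longrightarrow> h < d1 \<Longrightarrow>
      \<bar>f (x + h *\<^sub>R u + h *\<^sub>R v) - f (x + h *\<^sub>R u) - f (x + h *\<^sub>R v) + f x - h\<^sup>2 * L v\<bar> \<le> e / 2 * h\<^sup>2"
      using second_difference_estimate[OF U D L e2] by blast
    obtain d2 where d2: "d2 > 0" "\<And>h. 0 < h \<Longrightarrow> h < d2 \<Longrightarrow>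
      \<bar>f (x + h *\<^sub>R v + h *\<^sub>R u) - f (x + h *\<^sub>R v) - f (x + h *\<^sub>R u) + f x - h\<^sup>2 * K u\<bar> \<le> e / 2 * h\<^sup>2"
      using second_difference_estimate[OF U D K e2] by blast
    define h where "h = min d1 d2 / 2"
    have h: "0 < h" "h < d1" "h < d2" using d1(1) d2(1) by (auto simp: h_def)
    have "x + h *\<^sub>R v + h *\<^sub>R u = x + h *\<^sub>R u + h *\<^sub>R v" by (simp add: algebra_simps)
    note d2' = d2(2)[OF h(1,3), unfolded this]
    have "\<bar>h\<^sup>2 * L v - h\<^sup>2 * K u\<bar> \<le> e / 2 * h\<^sup>2 + e / 2 * h\<^sup>2"
      using d1(2)[OF h(1,2)] d2' by linarith
    then have "\<bar>h\<^sup>2 * (L v - K u)\<bar> \<le> h\<^sup>2 * e"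
      by (simp add: right_diff_distrib mult.commute[of e])
    then have "h\<^sup>2 * \<bar>L v - K u\<bar> \<le> h\<^sup>2 * e"
      by (simp only: abs_mult abs_power2)
    then show ?thesis using h by simp
  qed
  then have "\<bar>L v - K u\<bar> \<le> 0" by (rule field_le_epsilon)
  then show ?thesis by simp
qed

section \<open>Smooth functions\<close>

text \<open>
  Smoothness is defined by recursion through directional derivatives, so constants, sums, linear
  images and restrictions to lines are treated by induction on the order of differentiability: the
  derivative, given by the usual rule, is again a function of the same kind.
\<close>

lemma smooth_on_differentiable:
  assumes "smooth_on S f" "x \<in> S"
  shows "f differentiable (at x)"
proof -
  have "Ck_on (Suc 0) S f" using assms by (simp add: smooth_on_def del: Ck_on.simps)
  then show ?thesis using assms by simp
qed

lemma smooth_on_has_derivative: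
  assumes "smooth_on S f" "x \<in> S"
  shows "(f has_derivative frechet_derivative f (at x)) (at x)"
  using smooth_on_differentiable[OF assms] frechet_derivative_works by blast

lemma smooth_on_directional_derivative:
  assumes "smooth_on S f"
  shows "smooth_on S (\<lambda>x. frechet_derivative f (at x) v)"
  unfolding smooth_on_def
proof
  fix k
  have "Ck_on (Suc k) S f" using assms by (simp add: smooth_on_def del: Ck_on.simps)
  then show "Ck_on k S (\<lambda>x. frechet_derivative f (at x) v)" by simp
qed

lemma smooth_on_partial:
  assumes "smooth_on S f"
  shows "smooth_on S (partial j f)"
  unfolding partial_def[abs_def] using assms by (rule smooth_on_directional_derivative)

lemma smooth_on_derivative_symmetric:
  fixes f :: "'a::euclidean_space \<Rightarrow> real"
  assumes "open S" "smooth_on S f" "x \<in> S"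
  shows "frechet_derivative (\<lambda>y. frechet_derivative f (at y) u) (at x) v
       = frechet_derivative (\<lambda>y. frechet_derivative f (at y) v) (at x) u"
  using assms
  by (intro second_derivative_symmetric[of S x f "\<lambda>y. frechet_derivative f (at y)"]
        smooth_on_has_derivative smooth_on_directional_derivative)

lemma frechet_derivative_cong_open:
  assumes "open S" "x \<in> S" "\<And>y. y \<in> S \<Longrightarrow> f y = g y"
  shows "frechet_derivative f (at x) = frechet_derivative g (at x)"
proof -
  have "(f has_derivative D) (at x) \<longleftrightarrow> (g has_derivative D) (at x)" for D
    using has_derivative_transform_within_open[OF _ assms(1,2)] assms(3) by metis
  then show ?thesis by (simp add: frechet_derivative_def)
qed

lemma Ck_on_cong:
  assumes "open S" "\<And>x. x \<in> S \<Longrightarrow> f x = g x" "Ck_on k S f"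
  shows "Ck_on k S g"
  using assms(2,3)
proof (induction k arbitrary: f g)
  case 0
  then show ?case using continuous_on_cong by auto
next
  case (Suc k)
  have "g differentiable (at x)" if "x \<in> S" for x
  proof -
    have "(f has_derivative frechet_derivative f (at x)) (at x)"
      using Suc.prems(2) that by (simp flip: frechet_derivative_works)
    then have "(g has_derivative frechet_derivative f (at x)) (at x)"
      by (rule has_derivative_transform_within_open[OF _ assms(1) that Suc.prems(1)])
    then show ?thesis by (auto simp: differentiable_def)
  qed
  moreover have "Ck_on k S (\<lambda>x. frechet_derivative g (at x) v)" for v
  proof (rule Suc.IH)
    show "frechet_derivative f (at x) v = frechet_derivative g (at x) v" if "x \<in> S" for x
      using frechet_derivative_cong_open[OF assms(1) that Suc.prems(1)] by simp
    show "Ck_on k S (\<lambda>x. frechet_derivative f (at x) v)"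
      using Suc.prems(2) by simp
  qed
  ultimately show ?case by simp
qed

text \<open>
  Here the derivative may be given by any formula valid on \<open>S\<close>; openness of \<open>S\<close> makes the values of
  the Frechet derivative off \<open>S\<close> irrelevant.
\<close>

lemma Ck_on_SucI:
  assumes "open S" "\<And>x. x \<in> S \<Longrightarrow> (f has_derivative D x) (at x)"
    and "\<And>v. Ck_on k S (\<lambda>x. D x v)"
  shows "Ck_on (Suc k) S f"
proof -
  have "Ck_on k S (\<lambda>x. frechet_derivative f (at x) v)" for v
  proof (rule Ck_on_cong[OF assms(1)])
    show "D x v = frechet_derivative f (at x) v" if "x \<in> S" for x
      using frechet_derivative_at[OF assms(2)[OF that]] by simp
  qed (rule assms(3))
  moreover have "f differentiable (at x)" if "x \<in> S" for x
    using assms(2)[OF that] unfolding differentiable_def by blast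
  ultimately show ?thesis by simp
qed

lemma smooth_on_const:
  assumes "open S"
  shows "smooth_on S (\<lambda>x. c)"
proof -
  have "Ck_on k S (\<lambda>x. c)" for k
  proof (induction k arbitrary: c)
    case (Suc k)
    show ?case
      by (rule Ck_on_SucI[where D = "\<lambda>x v. 0", OF assms]) (simp_all add: Suc)
  qed simp
  then show ?thesis by (simp add: smooth_on_def)
qed

lemma smooth_on_ident:
  fixes S :: "'a::euclidean_space set"
  assumes "open S"
  shows "smooth_on S (\<lambda>x. x)"
  unfolding smooth_on_def
proof
  fix k show "Ck_on k S (\<lambda>x. x)"
  proof (cases k)
    case (Suc l)
    have "Ck_on l S (\<lambda>x. v)" for v :: 'a
      using smooth_on_const[OF assms, of v] by (simp add: smooth_on_def)
    then show ?thesis unfolding Suc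
      by (intro Ck_on_SucI[where D = "\<lambda>x v. v", OF assms]) simp_all
  qed (simp add: continuous_on_id)
qed

lemma smooth_on_bounded_linear:
  assumes S: "open S" and L: "bounded_linear L" and f: "smooth_on S f"
  shows "smooth_on S (\<lambda>x. L (f x))"
proof -
  have "Ck_on k S (\<lambda>x. L (f x))" if "Ck_on k S f" for k
    using that
  proof (induction k arbitrary: f)
    case 0
    then show ?case using L by (simp add: bounded_linear.continuous_on)
  next
    case (Suc k)
    show ?case
    proof (rule Ck_on_SucI[OF S])
      show "((\<lambda>x. L (f x)) has_derivative (\<lambda>v. L (frechet_derivative f (at x) v))) (at x)"
        if "x \<in> S" for x
        using that Suc.prems
        by (intro bounded_linear.has_derivative[OF L]) (simp flip: frechet_derivative_works)
      show "Ck_on k S (\<lambda>x. L (frechet_derivative f (at x) v))" for v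
        using Suc.prems by (intro Suc.IH) simp
    qed
  qed
  then show ?thesis using f by (simp add: smooth_on_def)
qed

lemma smooth_on_add:
  assumes S: "open S" and f: "smooth_on S f" and g: "smooth_on S g"
  shows "smooth_on S (\<lambda>x. f x + g x)"
proof -
  have "Ck_on k S (\<lambda>x. f x + g x)" if "Ck_on k S f" "Ck_on k S g" for k
    using that
  proof (induction k arbitrary: f g)
    case 0
    then show ?case by (simp add: continuous_on_add)
  next
    case (Suc k)
    show ?case
    proof (rule Ck_on_SucI[OF S])
      show "((\<lambda>x. f x + g x) has_derivative
          (\<lambda>v. frechet_derivative f (at x) v + frechet_derivative g (at x) v)) (at x)"
        if "x \<in> S" for x
        using that Suc.prems
        by (intro has_derivative_add) (simp_all flip: frechet_derivative_works)
      show "Ck_on k S (\<lambda>x. frechet_derivative f (at x) v + frechet_derivative g (at x) v)" for v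
        using Suc.prems by (intro Suc.IH) simp_all
    qed
  qed
  then show ?thesis using f g by (simp add: smooth_on_def)
qed

lemma smooth_on_sum:
  assumes "open S" "\<And>i. i \<in> A \<Longrightarrow> smooth_on S (f i)"
  shows "smooth_on S (\<lambda>x. \<Sum>i\<in>A. f i x)"
  using assms(2)
  by (induction A rule: infinite_finite_induct)
    (auto intro: smooth_on_add smooth_on_const assms(1))

lemma smooth_on_along_line:
  fixes f :: "'a::euclidean_space \<Rightarrow> 'b::real_normed_vector"
  assumes T: "open T" and sub: "\<And>t. t \<in> T \<Longrightarrow> x + t *\<^sub>R u \<in> S" and f: "smooth_on S f"
  shows "smooth_on T (\<lambda>t::real. f (x + t *\<^sub>R u))"
proof -
  have "Ck_on k T (\<lambda>t. f (x + t *\<^sub>R u))" if "smooth_on S f" for k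
    using that
  proof (induction k arbitrary: f)
    case 0
    then have "continuous_on S f"
      unfolding smooth_on_def by (metis Ck_on.simps(1))
    then show ?case
      using sub by (auto intro!: continuous_on_compose2[of S f] continuous_intros)
  next
    case (Suc k)
    show ?case
    proof (rule Ck_on_SucI[OF T])
      fix t assume t: "t \<in> T"
      have "((\<lambda>t. x + t *\<^sub>R u) has_derivative (\<lambda>s. s *\<^sub>R u)) (at t)"
        by (auto intro!: derivative_eq_intros)
      from has_derivative_compose[OF this smooth_on_has_derivative[OF Suc.prems sub[OF t]]]
      show "((\<lambda>t. f (x + t *\<^sub>R u)) has_derivative
          (\<lambda>s. frechet_derivative f (at (x + t *\<^sub>R u)) (s *\<^sub>R u))) (at t)" .
    next
      show "Ck_on k T (\<lambda>t. frechet_derivative f (at (x + t *\<^sub>R u)) (s *\<^sub>R u))" for s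
        by (rule Suc.IH) (rule smooth_on_directional_derivative[OF Suc.prems])
    qed
  qed
  then show ?thesis using f by (simp add: smooth_on_def)
qed

section \<open>Tangent vectors of the graph\<close>

text \<open>
  This is the differential at \<open>x\<close> of the gradient map \<open>y \<mapsto> (\<partial>\<phi>/\<partial>x\<^sub>j)\<close>, applied to \<open>u\<close>. That it is the
  Hessian matrix times \<open>u\<close> depends on the symmetry of second derivatives.
\<close>

abbreviation hessian_apply ::
    "(real^'m::finite \<Rightarrow> real) \<Rightarrow> real^'m \<Rightarrow> real^'m \<Rightarrow> real^'m" where
  "hessian_apply \<phi> x u \<equiv> (\<chi> j. frechet_derivative (partial j \<phi>) (at x) u)"

text \<open>
  The curve over the line \<open>t \<mapsto> x + t u\<close> stays in the graph for small \<open>t\<close> and has this velocity.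
\<close>

lemma tangent_vector_derivative_graph:
  fixes \<phi> :: "real^'m::finite \<Rightarrow> real"
  assumes U: "open U" "x \<in> U" and \<phi>: "smooth_on U \<phi>" and M: "derivative_graph U \<phi> \<subseteq> M"
  shows "(u, hessian_apply \<phi> x u) \<in> tangent_space M (x, \<chi> j. partial j \<phi> x)"
proof -
  have "open ((\<lambda>t::real. x + t *\<^sub>R u) -` U)"
    by (rule open_vimage[OF U(1)]) (auto intro!: continuous_intros)
  then obtain \<epsilon> where \<epsilon>: "\<epsilon> > 0" "ball 0 \<epsilon> \<subseteq> (\<lambda>t::real. x + t *\<^sub>R u) -` U"
    using U(2) open_contains_ball by (metis (mono_tags, lifting) add.right_neutral scale_eq_0_iff vimage_eq)
  let ?T = "{-\<epsilon><..<\<epsilon>}"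
  have T: "x + t *\<^sub>R u \<in> U" if "t \<in> ?T" for t
    using that \<epsilon>(2) by (auto simp: subset_iff)
  let ?G = "\<lambda>t::real. \<chi> j. partial j \<phi> (x + t *\<^sub>R u)"
  let ?\<gamma> = "\<lambda>t. (x + t *\<^sub>R u, ?G t)"
  \<comment> \<open>In this form smoothness reduces to that of the real functions \<open>partial j \<phi>\<close> along the line.\<close>
  have sum: "?\<gamma> t = (x, 0) + ((t *\<^sub>R (u, 0)) + (\<Sum>j\<in>UNIV. partial j \<phi> (x + t *\<^sub>R u) *\<^sub>R (0, axis j 1)))" for t
    by (auto simp: prod_eq_iff fst_sum snd_sum vec_eq_iff axis_def if_distrib[of "\<lambda>z. _ * z"] cong: if_cong)
  have "smooth_on ?T ?\<gamma>"
    unfolding sum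
    using smooth_on_along_line[OF open_greaterThanLessThan T smooth_on_partial[OF \<phi>]]
    by (intro smooth_on_add smooth_on_const smooth_on_sum
        smooth_on_bounded_linear[OF _ bounded_linear_scaleR_left] smooth_on_ident) auto
  moreover have "?\<gamma> ` ?T \<subseteq> M"
    using T M by (auto simp: derivative_graph_def)
  moreover have "(?\<gamma> has_vector_derivative (u, hessian_apply \<phi> x u)) (at 0)"
  proof -
    have line: "((\<lambda>t. x + t *\<^sub>R u) has_derivative (\<lambda>s. s *\<^sub>R u)) (at 0)"
      by (auto intro!: derivative_eq_intros)
    have "((\<lambda>t. partial j \<phi> (x + t *\<^sub>R u)) has_derivative
        (\<lambda>s. s * frechet_derivative (partial j \<phi>) (at x) u)) (at 0)" for j
    proof -
      have d: "(partial j \<phi> has_derivative frechet_derivative (partial j \<phi>) (at x)) (at (x + 0 *\<^sub>R u))"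
        using smooth_on_has_derivative[OF smooth_on_partial[OF \<phi>] U(2)] by simp
      show ?thesis
        using has_derivative_compose[OF line d]
          linear_scale[OF bounded_linear.linear[OF has_derivative_bounded_linear[OF d]]] by simp
    qed
    then have "(?G has_derivative (\<lambda>s. s *\<^sub>R hessian_apply \<phi> x u)) (at 0)"
      by (subst has_derivative_componentwise_within)
        (auto simp: Basis_vec_def inner_axis)
    then show ?thesis
      using line has_derivative_Pair by (fastforce simp: has_vector_derivative_def)
  qed
  ultimately show ?thesis
    unfolding tangent_space_def using \<epsilon>(1) by (intro CollectI exI[of _ ?\<gamma>] exI[of _ \<epsilon>]) simp
qed

section \<open>Coordinate expressions of the forms\<close>

lemma dX_apply: "dX i p v = fst v $ i"
  unfolding dX_def differential_def
  by (subst frechet_derivative_at[symmetric]) (auto intro!: derivative_eq_intros bounded_linear.has_derivative[OF bounded_linear_vec_nth])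

lemma dXi_apply: "dXi i p v = snd v $ i"
  unfolding dXi_def differential_def
  by (subst frechet_derivative_at[symmetric]) (auto intro!: derivative_eq_intros bounded_linear.has_derivative[OF bounded_linear_vec_nth])

lemma dx_apply: "dx i x v = v $ i"
  unfolding dx_def differential_def
  by (subst frechet_derivative_at[symmetric]) (auto intro!: derivative_eq_intros bounded_linear.has_derivative[OF bounded_linear_vec_nth])

lemma Omega2_tangent_graph:
  "Omega2 w p (u, a) (v, b) = kaehler_form w x u v
     + (\<Sum>i\<in>UNIV. \<Sum>j\<in>UNIV. matrix_inv w $ i $ j * (a $ i * b $ j - b $ i * a $ j))"
  by (simp add: Omega2_def kaehler_form_def wedge_def dX_apply dXi_apply dx_apply)

text \<open>
  The row sum differentiates each \<open>\<phi>\<^sub>j\<close> in a fixed direction \<open>a\<close>, whereas the right-hand side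
  differentiates \<open>\<phi>\<^sub>a\<close> along \<open>v\<close>: the metric has to be transposed.
\<close>

lemma kaehler_metric_mult_vector:
  fixes \<phi> :: "real^'m::finite \<Rightarrow> real"
  assumes "open U" "y \<in> U" "smooth_on U \<phi>"
  shows "kaehler_metric \<phi> y *v v = hessian_apply \<phi> y v"
proof -
  have "(\<Sum>j\<in>UNIV. partial a (partial j \<phi>) y * v $ j) = frechet_derivative (partial a \<phi>) (at y) v" for a
  proof -
    have lin: "linear (frechet_derivative (partial a \<phi>) (at y))"
      using smooth_on_differentiable[OF smooth_on_partial[OF assms(3)] assms(2)]
      by (rule linear_frechet_derivative)
    have "frechet_derivative (partial a \<phi>) (at y) v
        = frechet_derivative (partial a \<phi>) (at y) (\<Sum>j\<in>UNIV. v $ j *s axis j 1)"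
      by (simp add: basis_expansion)
    also have "\<dots> = (\<Sum>j\<in>UNIV. v $ j * partial j (partial a \<phi>) y)"
      by (simp add: linear_sum[OF lin] linear_scale[OF lin] scalar_mult_eq_scaleR partial_def[of _ "partial a \<phi>"])
    also have "\<dots> = (\<Sum>j\<in>UNIV. partial a (partial j \<phi>) y * v $ j)"
      using smooth_on_derivative_symmetric[OF assms(1,3,2)]
      by (intro sum.cong refl) (simp add: partial_def[abs_def])
    finally show ?thesis by simp
  qed
  then show ?thesis
    by (simp add: vec_eq_iff matrix_vector_mult_def kaehler_metric_def)
qed

text \<open>
  Regrouping the metric with \<open>v\<close> leaves a single derivative along \<open>v\<close>, so that the next
  differentiation meets only a product of two scalar functions with constant coefficients.
\<close>

lemma endo_act_complex_structure_differential:
  fixes \<phi> :: "real^'m::finite \<Rightarrow> real"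
  assumes "open U" "y \<in> U" "smooth_on U \<phi>"
  shows "endo_act (complex_structure w \<phi>) (differential \<phi>) y v
    = (\<Sum>i\<in>UNIV. \<Sum>a\<in>UNIV. matrix_inv w $ i $ a * (partial i \<phi> y * hessian_apply \<phi> y v $ a))"
proof -
  have "endo_act (complex_structure w \<phi>) (differential \<phi>) y v
    = (\<Sum>i\<in>UNIV. \<Sum>a\<in>UNIV. matrix_inv w $ i $ a * (partial i \<phi> y * (kaehler_metric \<phi> y *v v) $ a))"
    unfolding endo_act_def complex_structure_def dx_apply differential_def partial_def[symmetric] matrix_vector_mult_def
    by (simp add: sum_distrib_left sum_distrib_right mult_ac) (intro sum.cong refl sum.swap)
  then show ?thesis unfolding kaehler_metric_mult_vector[OF assms] .
qed

text \<open>
  By the product rule the derivative along \<open>u\<close> has a term with third derivatives of \<open>\<phi>\<close> and a term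
  quadratic in second derivatives. The first is symmetric in \<open>u\<close> and \<open>v\<close> and drops out.
\<close>

lemma ext_deriv_complex_structure_differential:
  fixes \<phi> :: "real^'m::finite \<Rightarrow> real"
  assumes "open U" "x \<in> U" "smooth_on U \<phi>"
  shows "ext_deriv (endo_act (complex_structure w \<phi>) (differential \<phi>)) x u v
    = (\<Sum>i\<in>UNIV. \<Sum>j\<in>UNIV. matrix_inv w $ i $ j *
        (hessian_apply \<phi> x u $ i * hessian_apply \<phi> x v $ j
         - hessian_apply \<phi> x v $ i * hessian_apply \<phi> x u $ j))"
proof -
  let ?D = "\<lambda>i. frechet_derivative (partial i \<phi>)"
  let ?D2 = "\<lambda>i v. frechet_derivative (\<lambda>y. ?D i (at y) v)"
  have deriv: "frechet_derivative (\<lambda>y. endo_act (complex_structure w \<phi>) (differential \<phi>) y v) (at x) u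
      = (\<Sum>i\<in>UNIV. \<Sum>a\<in>UNIV. matrix_inv w $ i $ a *
          (partial i \<phi> x * ?D2 a v (at x) u + ?D i (at x) u * ?D a (at x) v))" for u v
  proof -
    note d1 = smooth_on_has_derivative[OF smooth_on_partial[OF assms(3)] assms(2)]
    note d2 = smooth_on_has_derivative[OF smooth_on_directional_derivative
        [OF smooth_on_partial[OF assms(3)]] assms(2)]
    have "((\<lambda>y. \<Sum>i\<in>UNIV. \<Sum>a\<in>UNIV. matrix_inv w $ i $ a * (partial i \<phi> y * ?D a (at y) v))
        has_derivative (\<lambda>u. \<Sum>i\<in>UNIV. \<Sum>a\<in>UNIV. matrix_inv w $ i $ a *
          (partial i \<phi> x * ?D2 a v (at x) u + ?D i (at x) u * ?D a (at x) v))) (at x)"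
      by (intro has_derivative_sum has_derivative_mult_right has_derivative_mult d1 d2)
    then have "((\<lambda>y. endo_act (complex_structure w \<phi>) (differential \<phi>) y v)
        has_derivative (\<lambda>u. \<Sum>i\<in>UNIV. \<Sum>a\<in>UNIV. matrix_inv w $ i $ a *
          (partial i \<phi> x * ?D2 a v (at x) u + ?D i (at x) u * ?D a (at x) v))) (at x)"
      by (rule has_derivative_transform_within_open[OF _ assms(1,2)])
        (simp add: endo_act_complex_structure_differential[OF assms(1) _ assms(3)])
    from frechet_derivative_at[OF this, symmetric] show ?thesis by simp
  qed
  have sym: "?D2 a v (at x) u = ?D2 a u (at x) v" for a
    by (rule smooth_on_derivative_symmetric[OF assms(1) smooth_on_partial[OF assms(3)] assms(2)])
  show ?thesis
    unfolding ext_deriv_def deriv sum_subtractf[symmetric]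
    by (intro sum.cong refl) (simp add: sym algebra_simps)
qed

theorem proposition3:
  fixes n :: nat
    and \<sigma> :: "real^'m::finite \<Rightarrow> real^'m \<Rightarrow> real"
    and w :: "real^'m^'m"
    and M W :: "((real^'m) \<times> (real^'m)) set"
    and U :: "(real^'m) set"
    and \<phi> :: "real^'m \<Rightarrow> real"
  assumes "CARD('m) = 2 * n"
    and "symplectic_form \<sigma>"
    and "w = form_matrix \<sigma>"
    and "submanifold (2 * n) M"
    and "transversal_to_projection M fst"
    and "transversal_to_projection M snd"
    and "lagrangian_submanifold Omega1 M"
    and "lagrangian_submanifold (Omega2 w) M"
    and "open U" and "open W"
    and "smooth_on U \<phi>"
    and "M \<inter> W = derivative_graph U \<phi>"
  shows "kaehler_potential_on U (complex_structure w \<phi>) (kaehler_form w) \<phi>"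
  unfolding kaehler_potential_on_def
proof (intro ballI allI)
  fix x u v
  assume x: "x \<in> U"
  let ?p = "(x, \<chi> j. partial j \<phi> x)"
  have graph: "derivative_graph U \<phi> \<subseteq> M" using assms(12) by blast
  have "?p \<in> M" using graph x by (auto simp: derivative_graph_def)
  then have "Omega2 w ?p (u, hessian_apply \<phi> x u) (v, hessian_apply \<phi> x v) = 0"
    using assms(8) tangent_vector_derivative_graph[OF assms(9) x assms(11) graph]
    unfolding lagrangian_submanifold_def by blast
  then show "ext_deriv (endo_act (complex_structure w \<phi>) (differential \<phi>)) x u v
      = - kaehler_form w x u v"
    unfolding Omega2_tangent_graph[where x = x]
      ext_deriv_complex_structure_differential[OF assms(9) x assms(11)] by linarith
qed

end
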